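(* Let $F$ be a field of characteristic not $2$. Let $R$ be a finitely generated associative $F$-algebra with an involution $*:R\to R$, and let $K=\{a\in R\mid a^*=-a\}$. Suppose that $R$ contains an idempotent $e$ such that $ee^*=e^*e=0$ and $ReR=R(1-e-e^* )R=R$. Then the Lie algebra $[K,K]$ is finitely generated.
   Context: An involution is an $F$-linear map $*$ with $(ab)^*=b^*a^*$ and $(a^* )^*=a$. $K$ is a Lie algebra over $F$ under $[a,b]=ab-ba$, and $[K,K]$ is the $F$-span of all $[a,b]$, $a,b\in K$. For subsets, juxtaposition denotes the $F$-span of products, so $ReR=\mathrm{span}_F\{aeb: a,b\in R\}$ and $R(1-e-e^* )R=\mathrm{span}_F\{ab-aeb-ae^*b: a,b\in R\}$; if $R$ is not unital, $1$ denotes the identity of the unital hull of $R$. Finitely generated means finitely generated as an $F$-algebra of the respective type (associative or Lie). *)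

theory Defs
  imports "HOL-Computational_Algebra.Computational_Algebra"
begin

text \<open>
  Associative algebras over a field, not assumed to be unital: the carrier is a type of class
  \<open>ring\<close>, which does not include a unit.
\<close>

locale assoc_algebra = vector_space scale
  for scale :: "'f::field \<Rightarrow> 'r::ring \<Rightarrow> 'r" +
  assumes scale_mult_left: "scale c x * y = scale c (x * y)"
    and scale_mult_right: "x * scale c y = scale c (x * y)"

locale algebra_with_involution = assoc_algebra scale
  for scale :: "'f::field \<Rightarrow> 'r::ring \<Rightarrow> 'r" +
  fixes star :: "'r \<Rightarrow> 'r"
  assumes star_linear: "Vector_Spaces.linear scale scale star"
    and star_mult: "star (x * y) = star y * star x"
    and star_star: "star (star x) = x"

text \<open>
  A subset is a subalgebra with respect to an arbitrary product \<open>prd\<close>; taking \<open>prd\<close> to be the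
  ring multiplication or the commutator gives associative and Lie subalgebras respectively.
  Associative subalgebras need not contain a unit, even if the ambient ring has one.
\<close>

definition subalgebra_wrt ::
    "('f::field \<Rightarrow> 'r::ring \<Rightarrow> 'r) \<Rightarrow> ('r \<Rightarrow> 'r \<Rightarrow> 'r) \<Rightarrow> 'r set \<Rightarrow> bool" where
  "subalgebra_wrt scale prd A \<longleftrightarrow>
     module.subspace scale A \<and> (\<forall>x\<in>A. \<forall>y\<in>A. prd x y \<in> A)"

definition finitely_generated_wrt ::
    "('f::field \<Rightarrow> 'r::ring \<Rightarrow> 'r) \<Rightarrow> ('r \<Rightarrow> 'r \<Rightarrow> 'r) \<Rightarrow> 'r set \<Rightarrow> bool" where
  "finitely_generated_wrt scale prd A \<longleftrightarrow>
     subalgebra_wrt scale prd A \<and>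
     (\<exists>S. finite S \<and> S \<subseteq> A \<and> subalgebra_wrt scale prd hull S = A)"

definition commutator :: "'r::ring \<Rightarrow> 'r \<Rightarrow> 'r" where
  "commutator a b = a * b - b * a"

definition skew_elements :: "('r::ring \<Rightarrow> 'r) \<Rightarrow> 'r set" where
  "skew_elements star = {a. star a = - a}"

definition commutator_span ::
    "('f::field \<Rightarrow> 'r::ring \<Rightarrow> 'r) \<Rightarrow> 'r set \<Rightarrow> 'r set" where
  "commutator_span scale K = module.span scale {commutator a b | a b. a \<in> K \<and> b \<in> K}"

text \<open>The space \<open>R e R\<close>.\<close>

definition ideal_span :: "('f::field \<Rightarrow> 'r::ring \<Rightarrow> 'r) \<Rightarrow> 'r \<Rightarrow> 'r set" where
  "ideal_span scale e = module.span scale {a * e * b | a b. True}"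

text \<open>
  The space \<open>R (1 - e - f) R\<close>, where \<open>1\<close> is the unit of the unital hull of \<open>R\<close>; the products
  \<open>a (1 - e - f) b\<close> lie in \<open>R\<close> and are written out there.
\<close>

definition complement_ideal_span ::
    "('f::field \<Rightarrow> 'r::ring \<Rightarrow> 'r) \<Rightarrow> 'r \<Rightarrow> 'r \<Rightarrow> 'r set" where
  "complement_ideal_span scale e f =
     module.span scale {a * b - a * e * b - a * f * b | a b. True}"

context algebra_with_involution
begin

lemma commutator_span_skew_subset:
  "commutator_span scale (skew_elements star) \<subseteq> skew_elements star"
proof -
  interpret star: Vector_Spaces.linear scale scale star by (rule star_linear)
  have "subspace (skew_elements star)"
    by (rule subspaceI) (simp_all add: skew_elements_def star.add star.scale)
  then show ?thesis
    unfolding commutator_span_def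
    by (intro span_minimal)
       (auto simp: skew_elements_def commutator_def star.diff star_mult)
qed

lemma subalgebra_commutator_span_skew:
  "subalgebra_wrt scale commutator (commutator_span scale (skew_elements star))"
  unfolding subalgebra_wrt_def
proof (intro conjI ballI)
  show "subspace (commutator_span scale (skew_elements star))"
    by (simp add: commutator_span_def)
  fix x y
  assume "x \<in> commutator_span scale (skew_elements star)"
    and "y \<in> commutator_span scale (skew_elements star)"
  then have "x \<in> skew_elements star" "y \<in> skew_elements star"
    using commutator_span_skew_subset by auto
  then show "commutator x y \<in> commutator_span scale (skew_elements star)"
    unfolding commutator_span_def by (intro span_base) auto
qed

end

end

theory Submission
  imports Defs
begin

text \<open>
  Put \<open>f = star e\<close>, \<open>g = 1 - e - f\<close> and \<open>sk a = a - star a\<close>. The Lie algebra \<open>L = [K, K]\<close> is generated by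
  \<open>sk (eRg)\<close> and \<open>sk (gRe)\<close>, and for \<open>a\<close> in \<open>eRe\<close> the element \<open>sk a\<close> acts on these two spaces by left and
  right multiplication by \<open>a\<close>, up to sign. The set of \<open>a\<close> with \<open>sk a\<close> in \<open>L\<close> contains all commutators of
  \<open>eRe\<close>, and all products \<open>p r\<close> with \<open>p\<close> in \<open>eRf\<close>, \<open>r\<close> in \<open>fRe\<close> both symmetric or both skew. Now \<open>eRe\<close> is
  generated by finitely many products \<open>t = p r\<close> of factors that are each symmetric or skew, and
  then \<open>t t = (p r p) r\<close> is always of the previous kind. Modulo squares of generators and
  commutators, long words in the generators reduce to shorter ones, so finitely many squares and
  commutators, together with \<open>sk\<close> of finitely many elements of \<open>eRg\<close> and \<open>gRe\<close>, already generate \<open>L\<close>.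
\<close>

subsection \<open>Reduction of long words\<close>

text \<open>Induction from the right end of \<open>u\<close>. Exchanging \<open>t\<close> with the
  last letter \<open>s\<close> of the prefix leaves the commutator of \<open>s\<close> and
  \<open>t\<close> under the remaining prefix. By \<open>comm2\<close> it can be pulled to the front
  modulo \<open>Q\<close>, where it acts on a word without \<open>s\<close> and \<open>t\<close>;
  that word is in \<open>Q\<close> by \<open>short\<close>, so \<open>comm\<close> applies. The
  bound by \<open>m\<close> does not count \<open>t\<close>, so words of length \<open>m\<close>
  itself are covered.\<close>

lemma foldr_swap_front:
  fixes \<rho> :: "'a \<Rightarrow> 'v::ab_group_add \<Rightarrow> 'v"
  assumes add: "\<And>t a b. \<rho> t (a + b) = \<rho> t a + \<rho> t b"
    and Q: "0 \<in> Q" "\<And>a b. a \<in> Q \<Longrightarrow> b \<in> Q \<Longrightarrow> a - b \<in> Q"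
    and comm: "\<And>s t q. s \<in> T \<Longrightarrow> t \<in> T \<Longrightarrow> q \<in> Q \<Longrightarrow> \<rho> s (\<rho> t q) - \<rho> t (\<rho> s q) \<in> Q"
    and comm2: "\<And>u s t q. set u \<subseteq> T \<Longrightarrow> length u \<le> n \<Longrightarrow> s \<in> T \<Longrightarrow> t \<in> T \<Longrightarrow> q \<in> Q \<Longrightarrow>
       foldr \<rho> u (\<rho> s (\<rho> t q) - \<rho> t (\<rho> s q))
       - (\<rho> s (\<rho> t (foldr \<rho> u q)) - \<rho> t (\<rho> s (foldr \<rho> u q))) \<in> Q"
    and short: "\<And>w. set w \<subseteq> T \<Longrightarrow> length w < m \<Longrightarrow> foldr \<rho> w x \<in> Q"
    and "set u \<subseteq> T" "t \<in> T" "set v \<subseteq> T" "length u \<le> n" "length u + length v < m"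
  shows "foldr \<rho> (u @ t # v) x - foldr \<rho> (t # u @ v) x \<in> Q"
  using assms(6-)
proof (induction u arbitrary: v rule: rev_induct)
  case Nil
  then show ?case using Q by simp
next
  case (snoc s u)
  have Q_add: "a + b \<in> Q" if "a \<in> Q" "b \<in> Q" for a b
    using Q(2)[OF that(1) Q(2)[OF Q(1) that(2)]] by simp
  have diff: "foldr \<rho> w (a - b) = foldr \<rho> w a - foldr \<rho> w b" for w a b
  proof (induction w)
    case (Cons c w)
    show ?case using add[of c "foldr \<rho> w a - foldr \<rho> w b" "foldr \<rho> w b"] Cons by simp
  qed simp
  let ?q = "foldr \<rho> v x" and ?r = "foldr \<rho> (u @ v) x"
  have q: "?q \<in> Q" "?r \<in> Q" using snoc.prems by (auto intro!: short simp del: foldr_append)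
  have A: "foldr \<rho> u (\<rho> s (\<rho> t ?q) - \<rho> t (\<rho> s ?q))
      - (\<rho> s (\<rho> t (foldr \<rho> u ?q)) - \<rho> t (\<rho> s (foldr \<rho> u ?q))) \<in> Q"
    using snoc.prems q by (intro comm2) auto
  have B: "\<rho> s (\<rho> t ?r) - \<rho> t (\<rho> s ?r) \<in> Q"
    using snoc.prems q by (intro comm) auto
  have "foldr \<rho> u (\<rho> s (\<rho> t ?q) - \<rho> t (\<rho> s ?q)) \<in> Q"
    using Q_add[OF A B] by simp
  then have "foldr \<rho> (u @ s # t # v) x - foldr \<rho> (u @ t # s # v) x \<in> Q"
    by (simp add: diff)
  moreover have "foldr \<rho> (u @ t # s # v) x - foldr \<rho> (t # u @ s # v) x \<in> Q"
    using snoc.prems by (intro snoc.IH) auto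
  ultimately have "(foldr \<rho> (u @ s # t # v) x - foldr \<rho> (u @ t # s # v) x)
      + (foldr \<rho> (u @ t # s # v) x - foldr \<rho> (t # u @ s # v) x) \<in> Q"
    by (rule Q_add)
  then show ?case by (simp only: diff_add_cancel add_diff_eq append_assoc append_Cons append_Nil)
qed

text \<open>
  A word longer than \<open>card T\<close> repeats a letter within its first \<open>card T + 1\<close> places; modulo shorter
  words both occurrences can be moved to the front, where they form a square.
\<close>

lemma foldr_in_closed:
  fixes \<rho> :: "'a \<Rightarrow> 'v::ab_group_add \<Rightarrow> 'v"
  assumes "finite T"
    and add: "\<And>t a b. \<rho> t (a + b) = \<rho> t a + \<rho> t b"
    and Q: "0 \<in> Q" "\<And>a b. a \<in> Q \<Longrightarrow> b \<in> Q \<Longrightarrow> a - b \<in> Q"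
    and square: "\<And>t q. t \<in> T \<Longrightarrow> q \<in> Q \<Longrightarrow> \<rho> t (\<rho> t q) \<in> Q"
    and comm: "\<And>s t q. s \<in> T \<Longrightarrow> t \<in> T \<Longrightarrow> q \<in> Q \<Longrightarrow> \<rho> s (\<rho> t q) - \<rho> t (\<rho> s q) \<in> Q"
    and comm2: "\<And>u s t q. set u \<subseteq> T \<Longrightarrow> length u \<le> card T \<Longrightarrow> s \<in> T \<Longrightarrow> t \<in> T \<Longrightarrow> q \<in> Q \<Longrightarrow>
       foldr \<rho> u (\<rho> s (\<rho> t q) - \<rho> t (\<rho> s q))
       - (\<rho> s (\<rho> t (foldr \<rho> u q)) - \<rho> t (\<rho> s (foldr \<rho> u q))) \<in> Q"
    and base: "\<And>w. set w \<subseteq> T \<Longrightarrow> length w \<le> card T \<Longrightarrow> foldr \<rho> w x \<in> Q"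
    and "set w \<subseteq> T"
  shows "foldr \<rho> w x \<in> Q"
  using \<open>set w \<subseteq> T\<close>
proof (induction w rule: length_induct)
  case (1 w)
  have Q_cancel: "a \<in> Q" if "a - b \<in> Q" "b \<in> Q" for a b
    using Q(2)[OF that(1) Q(2)[OF Q(1) that(2)]] by simp
  show ?case
  proof (cases "length w \<le> card T")
    case True
    then show ?thesis using base 1 by blast
  next
    case False
    \<comment> \<open>Cutting after \<open>card T + 1\<close> letters forces a repetition and also
      bounds the prefixes that the repeated letter has to pass, as \<open>comm2\<close>
      requires.\<close>
    define p where "p = take (Suc (card T)) w"
    have p: "length p = Suc (card T)" "w = p @ drop (Suc (card T)) w" "set p \<subseteq> T"
      using False 1(2) by (auto simp: p_def dest: in_set_takeD)
    have "\<not> distinct p"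
    proof
      assume "distinct p"
      then have "length p \<le> card T"
        using p(3) \<open>finite T\<close> by (metis card_mono distinct_card)
      then show False using p by simp
    qed
    then obtain u0 t u1 u2 where d: "p = u0 @ [t] @ u1 @ [t] @ u2"
      using not_distinct_decomp by blast
    define v where "v = u2 @ drop (Suc (card T)) w"
    have w: "w = u0 @ t # u1 @ t # v" using p(2) d by (simp add: v_def)
    have sets: "set u0 \<subseteq> T" "t \<in> T" "set u1 \<subseteq> T" "set v \<subseteq> T" using 1(2) w by auto
    \<comment> \<open>The \<open>Suc\<close> accounts for the first copy of \<open>t\<close>: the
      second copy has to pass \<open>t # u0 @ u1\<close>.\<close>
    have len: "Suc (length u0 + length u1) \<le> card T" using p(1) d by simp
    have short: "\<And>w'. set w' \<subseteq> T \<Longrightarrow> length w' < length w \<Longrightarrow> foldr \<rho> w' x \<in> Q"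
      using 1(1) by blast
    have swap: "foldr \<rho> (u @ t # v) x - foldr \<rho> (t # u @ v) x \<in> Q"
      if "set u \<subseteq> T" "t \<in> T" "set v \<subseteq> T" "length u \<le> card T" "length u + length v < length w" for u t v
      using add Q comm comm2 short that by (rule foldr_swap_front)
    have 1: "foldr \<rho> (u0 @ t # (u1 @ t # v)) x - foldr \<rho> (t # u0 @ (u1 @ t # v)) x \<in> Q"
      by (rule swap) (use sets len in \<open>simp_all add: w\<close>)
    have 2: "foldr \<rho> ((t # u0 @ u1) @ t # v) x - foldr \<rho> (t # (t # u0 @ u1) @ v) x \<in> Q"
      by (rule swap) (use sets len in \<open>simp_all add: w\<close>)
    have "foldr \<rho> (u0 @ u1 @ v) x \<in> Q"
      by (rule short) (use sets in \<open>simp_all add: w\<close>)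
    then have 3: "foldr \<rho> (t # (t # u0 @ u1) @ v) x \<in> Q"
      using square[OF sets(2)] by simp
    show ?thesis
      using Q_cancel[OF 1] Q_cancel[OF 2 3] by (simp add: w)
  qed
qed

subsection \<open>Spans and hulls\<close>

context assoc_algebra
begin

lemma subalgebra_wrt_hull: "subalgebra_wrt scale prd (subalgebra_wrt scale prd hull S)"
  by (rule hull_in) (auto simp: subalgebra_wrt_def intro: subspace_Inter)

text \<open>The tool for exploiting fullness: a linear claim is checked on spanning products only.
  Linearity is given as two equations, so that maps such as \<open>\<lambda>p. e * p * e\<close> can
  be supplied directly.\<close>

lemma span_image_subset:
  assumes "\<And>r s. h (r + s) = h r + h s" "\<And>c r. h (scale c r) = scale c (h r)"
    and "subspace S" "\<And>b. b \<in> B \<Longrightarrow> h b \<in> S" "r \<in> span B"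
  shows "h r \<in> S"
proof -
  have "subspace {r. h r \<in> S}"
  proof (rule subspaceI)
    have "h 0 = 0" using assms(2)[of 0 0] by simp
    then show "0 \<in> {r. h r \<in> S}" using assms(3) by (simp add: subspace_0)
  qed (use assms in \<open>auto simp: subspace_add subspace_scale\<close>)
  then show ?thesis using span_induct[OF assms(5), of "\<lambda>r. h r \<in> S"] assms(4) by simp
qed

lemma span_mult_subset:
  assumes "subspace S" "\<And>a b. a \<in> A \<Longrightarrow> b \<in> B \<Longrightarrow> a * b \<in> S" "x \<in> span A" "y \<in> span B"
  shows "x * y \<in> S"
proof -
  have ay: "a * y \<in> S" if "a \<in> A" for a
    by (rule span_image_subset[where h = "\<lambda>y. a * y" and B = B])
       (use assms that in \<open>auto simp: distrib_left scale_mult_right\<close>)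
  show ?thesis
    by (rule span_image_subset[where h = "\<lambda>x. x * y" and B = A])
       (use assms ay in \<open>auto simp: distrib_right scale_mult_left\<close>)
qed

lemma finite_subset_span:
  assumes "finite S" "S \<subseteq> span P"
  obtains T where "finite T" "T \<subseteq> P" "S \<subseteq> span T"
  using assms
proof (induction S arbitrary: thesis rule: finite_induct)
  case empty
  then show ?case by (meson empty_subsetI finite.emptyI)
next
  case (insert s S)
  obtain T where T: "finite T" "T \<subseteq> P" "S \<subseteq> span T" using insert by auto
  have "s \<in> span P" using insert.prems(2) by simp
  then obtain T' r where T': "finite T'" "T' \<subseteq> P" and s: "s = (\<Sum>a\<in>T'. scale (r a) a)"
    unfolding span_explicit by blast
  have sT': "s \<in> span T'"
    unfolding s by (rule span_sum) (rule span_scale, rule span_base)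
  show ?case
  proof (rule insert.prems(1)[of "T \<union> T'"])
    show "insert s S \<subseteq> span (T \<union> T')"
      using T(3) sT' span_mono[of T "T \<union> T'"] span_mono[of T' "T \<union> T'"] by blast
  qed (use T T' in auto)
qed

end

subsection \<open>The Peirce decomposition\<close>

locale full_split_involution = algebra_with_involution scale star
  for scale :: "'f::field \<Rightarrow> 'r::ring \<Rightarrow> 'r" and star :: "'r \<Rightarrow> 'r" +
  fixes e :: 'r
  assumes two_neq_0: "(2::'f) \<noteq> 0"
    and idem: "e * e = e"
    and orth: "e * star e = 0" "star e * e = 0"
    and full: "ideal_span scale e = UNIV"
    and full_complement: "complement_ideal_span scale e (star e) = UNIV"
begin

sublocale star: Vector_Spaces.linear scale scale star
  by (rule star_linear)

abbreviation f :: 'r where "f \<equiv> star e"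

text \<open>
  The Peirce components for the orthogonal idempotents \<open>e\<close>, \<open>f\<close> and \<open>g = 1 - e - f\<close>. Since \<open>g\<close> lives
  in the unital hull only, multiplication by \<open>g\<close> is written as \<open>gl\<close> and \<open>gr\<close>.
\<close>

definition gl :: "'r \<Rightarrow> 'r" where "gl r = r - e * r - f * r"
definition gr :: "'r \<Rightarrow> 'r" where "gr r = r - r * e - r * f"
definition Ree :: "'r set" where "Ree = {a. e * a = a \<and> a * e = a}"
definition Ref :: "'r set" where "Ref = {p. e * p = p \<and> p * f = p}"
definition Rfe :: "'r set" where "Rfe = {p. f * p = p \<and> p * e = p}"
definition Reg :: "'r set" where "Reg = {x. e * x = x \<and> x * e = 0 \<and> x * f = 0}"
definition Rge :: "'r set" where "Rge = {y. y * e = y \<and> e * y = 0 \<and> f * y = 0}"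
definition Rgg :: "'r set" where "Rgg = {z. e * z = 0 \<and> z * e = 0 \<and> f * z = 0 \<and> z * f = 0}"

text \<open>Without a factor \<open>1 / 2\<close>, this doubles skew elements; since
  \<open>2\<close> is invertible, its image is still all of \<open>K\<close>.\<close>

definition sk :: "'r \<Rightarrow> 'r" where "sk a = a - star a"

abbreviation K :: "'r set" where "K \<equiv> skew_elements star"
abbreviation L :: "'r set" where "L \<equiv> commutator_span scale K"

lemma f_idem: "f * f = f"
  using star_mult[of e e] idem by simp

lemma ef_assoc: "e * (e * z) = e * z" "f * (f * z) = f * z" "e * (f * z) = 0" "f * (e * z) = 0"
  by (simp_all add: mult.assoc[symmetric] idem f_idem orth)

lemmas ef_simps = idem f_idem orth ef_assoc mult.assoc star_star star_mult
  star.add star.diff star.neg star.scale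

lemma mult_eq_0_via: "x * p = x \<Longrightarrow> p * y = 0 \<Longrightarrow> x * y = 0" for x y p :: 'r
  by (metis mult.assoc mult_zero_right)

lemma mult_eq_0_via': "x * p = 0 \<Longrightarrow> p * y = y \<Longrightarrow> x * y = 0" for x y p :: 'r
  by (metis mult.assoc mult_zero_left)

text \<open>\<open>star\<close> exchanges \<open>e\<close> and \<open>f\<close> and fixes
  \<open>g\<close>. So it maps \<open>eRe\<close> to \<open>fRf\<close>, \<open>eRg\<close> to
  \<open>gRf\<close>, \<open>gRe\<close> to \<open>fRg\<close>, and \<open>gRg\<close> to itself;
  this lemma and the next three record the resulting one-sided products.\<close>

lemma ReeD:
  assumes "a \<in> Ree"
  shows "e * a = a" "a * e = a" "f * a = 0" "a * f = 0"
    "f * star a = star a" "star a * f = star a" "e * star a = 0" "star a * e = 0"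
proof -
  show 1: "e * a = a" "a * e = a" using assms by (auto simp: Ree_def)
  show 2: "f * a = 0" "a * f = 0"
    using 1 orth mult_eq_0_via mult_eq_0_via' by blast+
  show "f * star a = star a" "star a * f = star a"
    using 1 star_mult[of a e] star_mult[of e a] by auto
  show "e * star a = 0" "star a * e = 0"
    using 2 star_mult[of a f] star_mult[of f a] by (auto simp: star_star)
qed

lemma RegD:
  assumes "x \<in> Reg"
  shows "e * x = x" "x * e = 0" "x * f = 0" "f * x = 0"
    "star x * f = star x" "f * star x = 0" "e * star x = 0" "star x * e = 0"
proof -
  show 1: "e * x = x" "x * e = 0" "x * f = 0" using assms by (auto simp: Reg_def)
  show 2: "f * x = 0"
    using 1 orth mult_eq_0_via' by blast
  show "star x * f = star x" "f * star x = 0" "e * star x = 0" "star x * e = 0"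
    using 1 2 star_mult[of e x] star_mult[of x e] star_mult[of x f] star_mult[of f x]
    by (auto simp: star_star)
qed

lemma RgeD:
  assumes "y \<in> Rge"
  shows "y * e = y" "e * y = 0" "f * y = 0" "y * f = 0"
    "f * star y = star y" "star y * f = 0" "star y * e = 0" "e * star y = 0"
proof -
  show 1: "y * e = y" "e * y = 0" "f * y = 0" using assms by (auto simp: Rge_def)
  show 2: "y * f = 0"
    using 1 orth mult_eq_0_via by blast
  show "f * star y = star y" "star y * f = 0" "star y * e = 0" "e * star y = 0"
    using 1 2 star_mult[of e y] star_mult[of y e] star_mult[of y f] star_mult[of f y]
    by (auto simp: star_star)
qed

lemma RggD:
  assumes "z \<in> Rgg"
  shows "e * z = 0" "z * e = 0" "f * z = 0" "z * f = 0"
    "e * star z = 0" "star z * e = 0" "f * star z = 0" "star z * f = 0"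
proof -
  show 1: "e * z = 0" "z * e = 0" "f * z = 0" "z * f = 0" using assms by (auto simp: Rgg_def)
  show "e * star z = 0" "star z * e = 0" "f * star z = 0" "star z * f = 0"
    using 1 star_mult[of e z] star_mult[of z e] star_mult[of z f] star_mult[of f z]
    by (auto simp: star_star)
qed

lemma subspace_corners: "subspace Ree" "subspace Reg" "subspace Rge"
  by (auto intro!: subspaceI simp: Ree_def Reg_def Rge_def distrib_left distrib_right
      scale_mult_left scale_mult_right)

lemma sk_add: "sk (a + b) = sk a + sk b"
  and sk_scale: "sk (scale c a) = scale c (sk a)"
  by (simp_all add: sk_def star.add star.diff star.neg star.scale star_star
      scale_right_diff_distrib)

lemma subspace_sk_preimage: "subspace M \<Longrightarrow> subspace {a. sk a \<in> M}"
  using sk_scale[of 0 0]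
  by (auto intro!: subspaceI simp: sk_add sk_scale subspace_add subspace_scale subspace_0)

lemma sk_in_K: "sk a \<in> K"
  by (simp add: sk_def skew_elements_def star.diff star_star)

lemma double: "a + a = scale 2 a"
  using scale_left_distrib[of 1 1 a] by simp

lemma halves: "scale (1 / 2) (a + a) = a"
  by (simp add: double two_neq_0)

lemma K_sk: "k \<in> K \<Longrightarrow> k = sk (scale (1 / 2) k)"
  using halves[of k] by (simp add: sk_def star.scale skew_elements_def scale_right_distrib)

subsection \<open>Commutators of Peirce components\<close>

lemma subspace_L: "subspace L"
  by (simp add: commutator_span_def)

lemma commutator_in_L: "k \<in> K \<Longrightarrow> l \<in> K \<Longrightarrow> commutator k l \<in> L"
  unfolding commutator_span_def by (intro span_base) auto

text \<open>Here and in the following formulas a product of two Peirce components survives only if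
  the adjacent idempotents agree.\<close>

lemma commutator_Ree_Ree:
  assumes "a \<in> Ree" "b \<in> Ree"
  shows "commutator (sk a) (sk b) = sk (commutator a b)"
proof -
  have "a * star b = 0" "star a * b = 0" "b * star a = 0" "star b * a = 0"
    by (meson ReeD assms mult_eq_0_via)+
  then show ?thesis by (simp add: commutator_def sk_def algebra_simps star_mult star.diff)
qed

lemma commutator_Ree_Reg:
  assumes "a \<in> Ree" "x \<in> Reg"
  shows "commutator (sk a) (sk x) = sk (a * x)"
proof -
  have "a * star x = 0" "star a * x = 0" "star x * a = 0" "star a * star x = 0"
    by (meson ReeD RegD assms mult_eq_0_via)+
  moreover have "x * a = 0" "x * star a = 0"
    by (meson ReeD RegD assms mult_eq_0_via')+
  ultimately show ?thesis by (simp add: commutator_def sk_def algebra_simps star_mult)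
qed

lemma commutator_Ree_Rge:
  assumes "a \<in> Ree" "y \<in> Rge"
  shows "commutator (sk a) (sk y) = - sk (y * a)"
proof -
  have "a * y = 0" "a * star y = 0" "star a * y = 0" "y * star a = 0"
    by (meson ReeD RgeD assms mult_eq_0_via)+
  moreover have "star y * a = 0" "star y * star a = 0"
    by (meson ReeD RgeD assms mult_eq_0_via')+
  ultimately show ?thesis by (simp add: commutator_def sk_def algebra_simps star_mult)
qed

lemma commutator_Reg_Rge:
  assumes "x \<in> Reg" "y \<in> Rge"
  shows "commutator (sk x) (sk y) = sk (x * y) - sk (y * x)"
proof -
  have "x * star y = 0"
    by (meson RegD RgeD assms mult_eq_0_via')
  moreover have "star x * y = 0" "y * star x = 0"
    by (meson RegD RgeD assms mult_eq_0_via)+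
  moreover have "star y * x = 0"
    by (meson RegD RgeD assms mult_eq_0_via')
  ultimately show ?thesis by (simp add: commutator_def sk_def algebra_simps star_mult)
qed

text \<open>The products \<open>x * star w\<close> lie in \<open>eRg gRf\<close> and span
  \<open>eRf\<close>, so this formula gives access to \<open>sk\<close> of \<open>eRf\<close>; the
  next one does the same for \<open>fRe\<close>.\<close>

lemma commutator_Reg_Reg:
  assumes "x \<in> Reg" "w \<in> Reg"
  shows "commutator (sk x) (sk w) = - sk (x * star w)"
proof -
  have "star x * w = 0" "star w * x = 0" "star x * star w = 0" "star w * star x = 0"
    by (meson RegD assms mult_eq_0_via)+
  moreover have "x * w = 0" "w * x = 0"
    by (meson RegD assms mult_eq_0_via')+
  ultimately show ?thesis by (simp add: commutator_def sk_def algebra_simps star_mult star_star)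
qed

lemma commutator_Rge_Rge:
  assumes "y \<in> Rge" "z \<in> Rge"
  shows "commutator (sk y) (sk z) = - sk (star y * z)"
proof -
  have "y * z = 0" "z * y = 0" "y * star z = 0" "z * star y = 0"
    by (meson RgeD assms mult_eq_0_via)+
  moreover have "star y * star z = 0" "star z * star y = 0"
    by (meson RgeD assms mult_eq_0_via')+
  ultimately show ?thesis by (simp add: commutator_def sk_def algebra_simps star_mult star_star)
qed

text \<open>Both \<open>z\<close> and \<open>star z\<close> lie in \<open>gRg\<close>, so both
  multiply \<open>x\<close> from the right; the action is therefore by \<open>sk z\<close>, not by
  \<open>z\<close> alone.\<close>

lemma commutator_Rgg_Reg:
  assumes "z \<in> Rgg" "x \<in> Reg"
  shows "commutator (sk z) (sk x) = - sk (x * sk z)"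
proof -
  have "z * x = 0" "star z * x = 0"
    by (meson RggD RegD assms mult_eq_0_via')+
  moreover have "star x * z = 0" "star x * star z = 0"
    by (meson RggD RegD assms mult_eq_0_via)+
  ultimately show ?thesis
    by (simp add: commutator_def sk_def algebra_simps star_mult star_star star.diff)
qed

lemma commutator_Rgg_Rge:
  assumes "z \<in> Rgg" "y \<in> Rge"
  shows "commutator (sk z) (sk y) = sk (sk z * y)"
proof -
  have "y * z = 0" "y * star z = 0"
    by (meson RggD RgeD assms mult_eq_0_via)+
  moreover have "z * star y = 0" "star z * star y = 0"
    by (meson RggD RgeD assms mult_eq_0_via')+
  ultimately show ?thesis
    by (simp add: commutator_def sk_def algebra_simps star_mult star_star star.diff)
qed

lemma commutator_Ree_Rgg:
  assumes "a \<in> Ree" "z \<in> Rgg"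
  shows "commutator (sk a) (sk z) = 0"
proof -
  have "a * z = 0" "a * star z = 0" "star a * z = 0" "star a * star z = 0"
    by (meson ReeD RggD assms mult_eq_0_via)+
  moreover have "z * a = 0" "z * star a = 0" "star z * a = 0" "star z * star a = 0"
    by (meson ReeD RggD assms mult_eq_0_via')+
  ultimately show ?thesis
    by (simp add: commutator_def sk_def algebra_simps)
qed

lemma corner_mult:
  "a \<in> Ree \<Longrightarrow> b \<in> Ree \<Longrightarrow> a * b \<in> Ree"
  "a \<in> Ree \<Longrightarrow> x \<in> Reg \<Longrightarrow> a * x \<in> Reg"
  "y \<in> Rge \<Longrightarrow> a \<in> Ree \<Longrightarrow> y * a \<in> Rge"
  "p \<in> Ref \<Longrightarrow> r \<in> Rfe \<Longrightarrow> p * r \<in> Ree"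
  "x \<in> Reg \<Longrightarrow> z \<in> Rgg \<Longrightarrow> x * sk z \<in> Reg"
  "z \<in> Rgg \<Longrightarrow> y \<in> Rge \<Longrightarrow> sk z * y \<in> Rge"
  "x \<in> Reg \<Longrightarrow> r \<in> Rfe \<Longrightarrow> star x * r \<in> Rge"
proof -
  show "a \<in> Ree \<Longrightarrow> b \<in> Ree \<Longrightarrow> a * b \<in> Ree"
    by (simp add: Ree_def mult.assoc) (simp add: mult.assoc[symmetric])
  show "p \<in> Ref \<Longrightarrow> r \<in> Rfe \<Longrightarrow> p * r \<in> Ree"
    by (simp add: Ree_def Ref_def Rfe_def mult.assoc) (simp add: mult.assoc[symmetric])
  show "a \<in> Ree \<Longrightarrow> x \<in> Reg \<Longrightarrow> a * x \<in> Reg"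
    by (simp add: Ree_def Reg_def mult.assoc) (simp add: mult.assoc[symmetric])
  show "y \<in> Rge \<Longrightarrow> a \<in> Ree \<Longrightarrow> y * a \<in> Rge"
    by (simp add: Ree_def Rge_def mult.assoc) (simp add: mult.assoc[symmetric])
  show "x * sk z \<in> Reg" if "x \<in> Reg" "z \<in> Rgg"
    using RegD[OF that(1)] RggD[OF that(2)]
    by (simp add: Reg_def sk_def mult.assoc algebra_simps) (simp add: mult.assoc[symmetric])
  show "sk z * y \<in> Rge" if "z \<in> Rgg" "y \<in> Rge"
    using RgeD[OF that(2)] RggD[OF that(1)]
    by (simp add: Rge_def sk_def mult.assoc algebra_simps) (simp add: mult.assoc[symmetric])
  show "star x * r \<in> Rge" if "x \<in> Reg" "r \<in> Rfe"
    using RegD[OF that(1)] that(2)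
    by (simp add: Rge_def Rfe_def mult.assoc) (simp add: mult.assoc[symmetric])
qed

lemma corner_proj:
  "e * gr a \<in> Reg" "gl b * e \<in> Rge" "e * a * e \<in> Ree" "e * a * f \<in> Ref" "f * a * e \<in> Rfe"
  "gl (gr a) \<in> Rgg"
  by (simp_all add: Reg_def Rge_def Ree_def Ref_def Rfe_def Rgg_def gl_def gr_def algebra_simps
      ef_simps)

subsection \<open>Consequences of fullness\<close>

lemma in_span_complement: "r \<in> span {a * b - a * e * b - a * f * b | a b. True}"
  using full_complement by (auto simp: complement_ideal_span_def)

lemma in_span_e: "r \<in> span {a * e * b | a b. True}"
  using full by (auto simp: ideal_span_def)

text \<open>Apply \<open>star\<close> to \<open>ReR = R\<close>.\<close>

lemma in_span_f: "r \<in> span {a * f * b | a b. True}"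
proof -
  have "star (star r) \<in> span {a * f * b | a b. True}"
  proof (rule span_image_subset[where h = star, OF _ _ _ _ in_span_e])
    fix t assume "t \<in> {a * e * b | a b. True}"
    then obtain a b where "t = a * e * b" by auto
    then have "star t = star b * f * star a" by (simp add: star_mult mult.assoc)
    then show "star t \<in> span {a * f * b | a b. True}" by (auto intro!: span_base)
  qed (auto simp: star.add star.scale)
  then show ?thesis by (simp add: star_star)
qed

text \<open>From \<open>R = RgR\<close> it follows that \<open>eRf = eRg gRf\<close>, and
  \<open>gRf\<close> is the image of \<open>eRg\<close> under \<open>star\<close>. The next two
  lemmas cut \<open>RgR\<close> down to \<open>fRe\<close> and \<open>eRe\<close> in the same
  way.\<close>

lemma Ref_span:
  assumes "p \<in> Ref"
  shows "p \<in> span {x * star w | x w. x \<in> Reg \<and> w \<in> Reg}"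
proof -
  have "e * p * f \<in> span {x * star w | x w. x \<in> Reg \<and> w \<in> Reg}"
  proof (rule span_image_subset[where h = "\<lambda>p. e * p * f", OF _ _ _ _ in_span_complement])
    fix t assume "t \<in> {a * b - a * e * b - a * f * b | a b. True}"
    then obtain a b where t: "t = a * b - a * e * b - a * f * b" by auto
    have "e * t * f = (e * gr a) * star (e * gr (star b))"
      by (simp add: t gr_def algebra_simps ef_simps)
    then show "e * t * f \<in> span {x * star w | x w. x \<in> Reg \<and> w \<in> Reg}"
      using corner_proj by (auto intro!: span_base)
  qed (auto simp: algebra_simps scale_mult_left scale_mult_right)
  then show ?thesis using assms by (simp add: Ref_def)
qed

lemma Rfe_span:
  assumes "p \<in> Rfe"
  shows "p \<in> span {star y * z | y z. y \<in> Rge \<and> z \<in> Rge}"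
proof -
  have "f * p * e \<in> span {star y * z | y z. y \<in> Rge \<and> z \<in> Rge}"
  proof (rule span_image_subset[where h = "\<lambda>p. f * p * e", OF _ _ _ _ in_span_complement])
    fix t assume "t \<in> {a * b - a * e * b - a * f * b | a b. True}"
    then obtain a b where t: "t = a * b - a * e * b - a * f * b" by auto
    have "f * t * e = star (gl (star a) * e) * (gl b * e)"
      by (simp add: t gl_def algebra_simps ef_simps)
    then show "f * t * e \<in> span {star y * z | y z. y \<in> Rge \<and> z \<in> Rge}"
      using corner_proj by (auto intro!: span_base)
  qed (auto simp: algebra_simps scale_mult_left scale_mult_right)
  then show ?thesis using assms by (simp add: Rfe_def)
qed

lemma Ree_span:
  assumes "p \<in> Ree"
  shows "p \<in> span {x * y | x y. x \<in> Reg \<and> y \<in> Rge}"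
proof -
  have "e * p * e \<in> span {x * y | x y. x \<in> Reg \<and> y \<in> Rge}"
  proof (rule span_image_subset[where h = "\<lambda>p. e * p * e", OF _ _ _ _ in_span_complement])
    fix t assume "t \<in> {a * b - a * e * b - a * f * b | a b. True}"
    then obtain a b where t: "t = a * b - a * e * b - a * f * b" by auto
    have "e * t * e = (e * gr a) * (gl b * e)"
      by (simp add: t gl_def gr_def algebra_simps ef_simps)
    then show "e * t * e \<in> span {x * y | x y. x \<in> Reg \<and> y \<in> Rge}"
      using corner_proj by (auto intro!: span_base)
  qed (auto simp: algebra_simps scale_mult_left scale_mult_right)
  then show ?thesis using assms by (simp add: Ree_def)
qed

text \<open>Here the other fullness condition is used: \<open>R = ReR\<close> gives
  \<open>gRg = gRe eRg\<close>.\<close>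

lemma Rgg_span:
  assumes "p \<in> Rgg"
  shows "p \<in> span {y * x | x y. x \<in> Reg \<and> y \<in> Rge}"
proof -
  have "gl (gr p) \<in> span {y * x | x y. x \<in> Reg \<and> y \<in> Rge}"
  proof (rule span_image_subset[where h = "\<lambda>p. gl (gr p)", OF _ _ _ _ in_span_e])
    fix t assume "t \<in> {a * e * b | a b. True}"
    then obtain a b where t: "t = a * e * b" by auto
    have "gl (gr t) = (gl a * e) * (e * gr b)"
      by (simp add: t gl_def gr_def algebra_simps ef_simps)
    then show "gl (gr t) \<in> span {y * x | x y. x \<in> Reg \<and> y \<in> Rge}"
      using corner_proj by (auto intro!: span_base)
  qed (auto simp: gl_def gr_def algebra_simps scale_mult_left scale_mult_right
      scale_right_diff_distrib)
  then show ?thesis using assms by (simp add: Rgg_def gl_def gr_def algebra_simps)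
qed

section \<open>Elements of \<open>[K, K]\<close> and signed products in the corner\<close>

lemma e_in_Ree: "e \<in> Ree"
  by (simp add: Ree_def idem)

text \<open>\<open>sk e\<close> acts as the identity on \<open>sk Reg\<close>, so
  \<open>sk x\<close> is the commutator of \<open>sk e\<close> and \<open>sk x\<close>. On
  \<open>sk Rge\<close> it acts as minus the identity.\<close>

lemma sk_Reg_in_L: "x \<in> Reg \<Longrightarrow> sk x \<in> L"
  using commutator_Ree_Reg[OF e_in_Ree, of x] commutator_in_L[OF sk_in_K sk_in_K, of e x]
  by (simp add: RegD)

lemma sk_Rge_in_L: "y \<in> Rge \<Longrightarrow> sk y \<in> L"
  using commutator_Ree_Rge[OF e_in_Ree, of y] commutator_in_L[OF sk_in_K sk_in_K, of e y]
    subspace_neg[OF subspace_L, of "- sk y"]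
  by (simp add: RgeD)

lemma sk_commutator_in_L: "a \<in> Ree \<Longrightarrow> b \<in> Ree \<Longrightarrow> sk (commutator a b) \<in> L"
  using commutator_Ree_Ree commutator_in_L sk_in_K by metis

text \<open>Since \<open>star (p * r) = r * p\<close>, the element \<open>sk (p * r)\<close> is
  itself the commutator of \<open>p\<close> and \<open>r\<close>.\<close>

lemma sk_skew_skew_in_L: "star p = - p \<Longrightarrow> star r = - r \<Longrightarrow> sk (p * r) \<in> L"
  using commutator_in_L[of p r] by (simp add: skew_elements_def sk_def star_mult commutator_def)

text \<open>Symmetric factors are not in \<open>K\<close>, so \<open>p\<close> is resolved into
  terms \<open>x * star w\<close>. In the sum of the commutators of \<open>sk x\<close> with
  \<open>sk (star w * q)\<close> and of \<open>sk w\<close> with \<open>sk (star x * q)\<close>, the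
  \<open>gRg\<close> parts are \<open>sk\<close> of \<open>star w * q * x\<close> and of
  \<open>star x * q * w\<close>. These two elements are exchanged by \<open>star\<close> because
  \<open>q\<close> is symmetric, so their \<open>sk\<close> cancel and \<open>sk\<close> of
  \<open>(x * star w + w * star x) * q\<close> remains.\<close>

lemma sk_sym_sym_in_L:
  assumes "p \<in> Ref" "star p = p" "q \<in> Rfe" "star q = q"
  shows "sk (p * q) \<in> L"
proof -
  have "sk ((p + star p) * q) \<in> L"
  proof (rule span_image_subset[where h = "\<lambda>p. sk ((p + star p) * q)", OF _ _ subspace_L _
        Ref_span[OF assms(1)]])
    fix t assume "t \<in> {x * star w | x w. x \<in> Reg \<and> w \<in> Reg}"
    then obtain x w where t: "t = x * star w" and xw: "x \<in> Reg" "w \<in> Reg" by auto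
    have "commutator (sk x) (sk (star w * q)) + commutator (sk w) (sk (star x * q)) \<in> L"
      by (intro subspace_add[OF subspace_L] commutator_in_L sk_in_K)
    moreover have "star w * q \<in> Rge" "star x * q \<in> Rge"
      using corner_mult xw assms by auto
    ultimately show "sk ((t + star t) * q) \<in> L"
      using xw by (simp add: commutator_Reg_Rge)
        (simp add: t sk_def algebra_simps star_mult star_star star.add assms)
  qed (auto simp: sk_add sk_scale distrib_right star.add star.scale scale_mult_left
      scale_right_distrib)
  then have "scale (1 / 2) (sk (p * q) + sk (p * q)) \<in> L"
    using assms(2) subspace_L subspace_scale by (auto simp: distrib_right sk_add)
  then show ?thesis by (simp add: halves)
qed

text \<open>The signs of \<open>p\<close> and \<open>r\<close> are independent. The two preceding
  lemmas treat equal signs only, which is why squares of these products are used below.\<close>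

definition signed_products :: "'r set" where
  "signed_products = {p * r | p r. p \<in> Ref \<and> r \<in> Rfe \<and>
     (star p = p \<or> star p = - p) \<and> (star r = r \<or> star r = - r)}"

lemma signed_products_subset: "signed_products \<subseteq> Ree"
  using corner_mult by (auto simp: signed_products_def)

text \<open>
  For \<open>t = p r\<close>, the square is \<open>(p r p) r\<close>, and \<open>p r p\<close> always has the same symmetry as \<open>r\<close>.
\<close>

lemma sk_square_in_L:
  assumes "t \<in> signed_products"
  shows "sk (t * t) \<in> L"
proof -
  obtain p r where t: "t = p * r" and pr: "p \<in> Ref" "r \<in> Rfe"
    and p: "star p = p \<or> star p = - p" and r: "star r = r \<or> star r = - r"
    using assms by (auto simp: signed_products_def)
  have tt: "t * t = (p * r * p) * r" by (simp add: t mult.assoc)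
  have s: "star (p * r * p) = star p * star r * star p" by (simp add: star_mult mult.assoc)
  have prp: "p * r * p \<in> Ref"
    using pr by (simp add: Ref_def mult.assoc) (simp add: mult.assoc[symmetric])
  show ?thesis
    using r
  proof
    assume r: "star r = r"
    then have "star (p * r * p) = p * r * p" using p s by auto
    then show ?thesis unfolding tt using prp pr r by (intro sk_sym_sym_in_L)
  next
    assume r: "star r = - r"
    then have "star (p * r * p) = - (p * r * p)" using p s by auto
    then show ?thesis unfolding tt using r by (intro sk_skew_skew_in_L)
  qed
qed

text \<open>\<open>R = RfR\<close> gives \<open>eRe = eRf fRe\<close>. Both factors are stable under
  \<open>star\<close>, so they split into symmetric and skew parts.\<close>

lemma Ree_subset_span_signed: "Ree \<subseteq> span signed_products"
proof
  fix a assume a: "a \<in> Ree"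
  have "e * a * e \<in> span signed_products"
  proof (rule span_image_subset[where h = "\<lambda>p. e * p * e", OF _ _ _ _ in_span_f])
    fix t assume "t \<in> {a * f * b | a b. True}"
    then obtain c d where t: "t = c * f * d" by auto
    define p r where "p = e * c * f" and "r = f * d * e"
    have pr: "p \<in> Ref" "r \<in> Rfe" "star p \<in> Ref" "star r \<in> Rfe"
      using corner_proj[of c] corner_proj[of d] corner_proj[of "star c"] corner_proj[of "star d"]
      by (simp_all add: p_def r_def star_mult star_star mult.assoc)
    have sums: "p + star p \<in> Ref" "p - star p \<in> Ref" "r + star r \<in> Rfe" "r - star r \<in> Rfe"
      using pr by (simp_all add: Ref_def Rfe_def algebra_simps)
    have signs: "star (p + star p) = p + star p" "star (p - star p) = - (p - star p)"
      "star (r + star r) = r + star r" "star (r - star r) = - (r - star r)"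
      by (simp_all add: star.add star.diff star_star)
    have "u * v \<in> span signed_products"
      if "u \<in> {p + star p, p - star p}" "v \<in> {r + star r, r - star r}" for u v
      using that sums signs unfolding signed_products_def by (intro span_base) blast
    \<comment> \<open>The four signed products add up to \<open>4 p r\<close>, which is then halved
      twice.\<close>
    then have "(p + star p) * (r + star r) + (p + star p) * (r - star r)
        + ((p - star p) * (r + star r) + (p - star p) * (r - star r)) \<in> span signed_products"
      by (intro span_add) auto
    also have "(p + star p) * (r + star r) + (p + star p) * (r - star r)
        + ((p - star p) * (r + star r) + (p - star p) * (r - star r))
        = (p * r + p * r) + (p * r + p * r)"
      by (simp add: algebra_simps)
    finally have "scale (1/2) (scale (1/2) ((p * r + p * r) + (p * r + p * r))) \<in> span signed_products"
      by (intro span_scale)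
    then have "p * r \<in> span signed_products" by (simp only: halves)
    then show "e * t * e \<in> span signed_products" by (simp add: t p_def r_def ef_simps)
  qed (auto simp: algebra_simps scale_mult_left scale_mult_right)
  then show "a \<in> span signed_products" using a by (simp add: Ree_def)
qed


section \<open>Generation of \<open>L\<close> by \<open>sk Reg\<close> and
  \<open>sk Rge\<close>\<close>

lemma commutator_add: "commutator (a + b) c = commutator a c + commutator b c"
  "commutator a (b + c) = commutator a b + commutator a c" for a b c :: 'r
  by (simp_all add: commutator_def algebra_simps)

lemma commutator_scale: "commutator a (scale c b) = scale c (commutator a b)"
  by (simp add: commutator_def scale_mult_left scale_mult_right scale_right_diff_distrib)

text \<open>The commutator with \<open>d\<close> is a derivation, so the elements of the hull that
  it sends into the hull form a Lie subalgebra, which contains \<open>S\<close>.\<close>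

lemma commutator_in_hull:
  assumes "\<And>s. s \<in> S \<Longrightarrow> commutator d s \<in> subalgebra_wrt scale commutator hull S"
    and "m \<in> subalgebra_wrt scale commutator hull S"
  shows "commutator d m \<in> subalgebra_wrt scale commutator hull S"
proof -
  let ?M = "subalgebra_wrt scale commutator hull S"
  have M: "subspace ?M" "\<And>x y. x \<in> ?M \<Longrightarrow> y \<in> ?M \<Longrightarrow> commutator x y \<in> ?M"
    using subalgebra_wrt_hull[of commutator S] by (auto simp: subalgebra_wrt_def)
  have "subalgebra_wrt scale commutator {m \<in> ?M. commutator d m \<in> ?M}"
  proof (rule subalgebra_wrt_def[THEN iffD2], intro conjI ballI)
    show "subspace {m \<in> ?M. commutator d m \<in> ?M}"
      using M(1) by (auto intro!: subspaceI simp: commutator_add commutator_scale subspace_add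
          subspace_scale subspace_0 commutator_def[of d 0])
    fix x y assume xy: "x \<in> {m \<in> ?M. commutator d m \<in> ?M}" "y \<in> {m \<in> ?M. commutator d m \<in> ?M}"
    have "commutator d (commutator x y)
        = commutator (commutator d x) y + commutator x (commutator d y)"
      by (simp add: commutator_def algebra_simps)
    then show "commutator x y \<in> {m \<in> ?M. commutator d m \<in> ?M}"
      using xy M by (auto intro!: subspace_add)
  qed
  then have "?M \<subseteq> {m \<in> ?M. commutator d m \<in> ?M}"
    using assms(1) by (intro hull_minimal) (auto intro: hull_inc)
  then show ?thesis using assms(2) by auto
qed

text \<open>
  Modulo the subalgebra \<open>M\<close> generated by \<open>sk Reg\<close> and \<open>sk Rge\<close>, the elements \<open>sk (x y)\<close> and
  \<open>sk (y x)\<close> agree, so every skew element is congruent both to one of \<open>sk Ree\<close> and to one of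
  \<open>sk Rgg\<close>; these two spaces commute and normalize \<open>M\<close>.
\<close>

lemma L_subset_hull: "L \<subseteq> subalgebra_wrt scale commutator hull (sk ` (Reg \<union> Rge))"
proof -
  define M where "M = subalgebra_wrt scale commutator hull (sk ` (Reg \<union> Rge))"
  have M: "subspace M" "\<And>x y. x \<in> M \<Longrightarrow> y \<in> M \<Longrightarrow> commutator x y \<in> M"
    using subalgebra_wrt_hull[of commutator "sk ` (Reg \<union> Rge)"]
    by (auto simp: subalgebra_wrt_def M_def)
  have gen: "sk x \<in> M" if "x \<in> Reg \<union> Rge" for x
    using that by (auto simp: M_def intro: hull_inc)
  have negM: "- x \<in> M \<longleftrightarrow> x \<in> M" for x
    using subspace_neg[OF M(1), of x] subspace_neg[OF M(1), of "- x"] by auto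
  have Ref: "sk p \<in> M" if p: "p \<in> Ref" for p
  proof (rule span_image_subset[where h = sk, OF _ _ M(1) _ Ref_span[OF p]])
    fix t assume "t \<in> {x * star w | x w. x \<in> Reg \<and> w \<in> Reg}"
    then obtain x w where "t = x * star w" "x \<in> Reg" "w \<in> Reg" by auto
    then show "sk t \<in> M" using commutator_Reg_Reg M(2) gen negM by (metis UnI1)
  qed (auto simp: sk_add sk_scale)
  have Rfe: "sk p \<in> M" if p: "p \<in> Rfe" for p
  proof (rule span_image_subset[where h = sk, OF _ _ M(1) _ Rfe_span[OF p]])
    fix t assume "t \<in> {star y * z | y z. y \<in> Rge \<and> z \<in> Rge}"
    then obtain y z where "t = star y * z" "y \<in> Rge" "z \<in> Rge" by auto
    then show "sk t \<in> M" using commutator_Rge_Rge M(2) gen negM by (metis UnI2)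
  qed (auto simp: sk_add sk_scale)
  have xy: "sk (x * y) - sk (y * x) \<in> M" if "x \<in> Reg" "y \<in> Rge" for x y
    using commutator_Reg_Rge[OF that] M(2) gen that by (metis UnI1 UnI2)
  have Rgg_sub: "subspace Rgg"
    by (auto intro!: subspaceI simp: Rgg_def distrib_left distrib_right scale_mult_left
        scale_mult_right)
  have yx_Rgg: "y * x \<in> Rgg" if "x \<in> Reg" "y \<in> Rge" for x y
    using RegD[OF that(1)] RgeD[OF that(2)]
    by (simp add: Rgg_def mult.assoc) (simp add: mult.assoc[symmetric])
  have xy_Ree: "x * y \<in> Ree" if "x \<in> Reg" "y \<in> Rge" for x y
    using RegD[OF that(1)] RgeD[OF that(2)]
    by (simp add: Ree_def mult.assoc) (simp add: mult.assoc[symmetric])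
  have congruent_sub: "subspace {a. \<exists>b\<in>B. sk a - sk b \<in> M}" (is "subspace ?S")
    if B: "subspace B" for B
  proof (rule subspaceI)
    show "0 \<in> ?S"
      using subspace_0[OF B] subspace_0[OF M(1)] by (auto intro!: bexI[of _ 0])
  next
    fix x y assume "x \<in> ?S" "y \<in> ?S"
    then obtain b c where bc: "b \<in> B" "c \<in> B" "sk x - sk b \<in> M" "sk y - sk c \<in> M" by auto
    have "sk (x + y) - sk (b + c) = (sk x - sk b) + (sk y - sk c)" by (simp add: sk_add)
    then have "sk (x + y) - sk (b + c) \<in> M" using subspace_add[OF M(1) bc(3,4)] by simp
    then show "x + y \<in> ?S" using subspace_add[OF B bc(1,2)] by blast
  next
    fix x c assume "x \<in> ?S"
    then obtain b where b: "b \<in> B" "sk x - sk b \<in> M" by auto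
    have "sk (scale c x) - sk (scale c b) = scale c (sk x - sk b)"
      by (simp add: sk_scale scale_right_diff_distrib)
    then have "sk (scale c x) - sk (scale c b) \<in> M" using subspace_scale[OF M(1) b(2)] by simp
    then show "scale c x \<in> ?S" using subspace_scale[OF B b(1)] by blast
  qed
  have Ree_to_Rgg: "\<exists>b\<in>Rgg. sk a - sk b \<in> M" if "a \<in> Ree" for a
    using Ree_span[OF that] congruent_sub[OF Rgg_sub]
  proof (rule span_induct)
    fix t assume "t \<in> {x * y | x y. x \<in> Reg \<and> y \<in> Rge}"
    then show "\<exists>b\<in>Rgg. sk t - sk b \<in> M" using xy yx_Rgg by blast
  qed
  have Rgg_to_Ree: "\<exists>a\<in>Ree. sk b - sk a \<in> M" if "b \<in> Rgg" for b
    using Rgg_span[OF that] congruent_sub[OF subspace_corners(1)]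
  proof (rule span_induct)
    fix t assume "t \<in> {y * x | x y. x \<in> Reg \<and> y \<in> Rge}"
    then obtain x y where t: "t = y * x" "x \<in> Reg" "y \<in> Rge" by auto
    then show "\<exists>a\<in>Ree. sk t - sk a \<in> M"
      using xy_Ree xy negM[of "sk (x * y) - sk (y * x)"] by auto
  qed
  have decomp: "\<exists>a\<in>Ree. \<exists>b\<in>Rgg. k - sk a - sk b \<in> M" if "k \<in> K" for k
  proof -
    define r where "r = scale (1 / 2) k"
    have k: "k = sk r" using K_sk[OF that] by (simp add: r_def)
    \<comment> \<open>The \<open>fRf\<close> part of \<open>r\<close> is folded into
      \<open>eRe\<close>, as \<open>sk (f * r * f) = - sk (e * star r * e)\<close>. The
      \<open>gRf\<close> and \<open>fRg\<close> parts are likewise moved to \<open>eRg\<close> and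
      \<open>gRe\<close>, which explains the terms in \<open>star r\<close> below.\<close>
    define a where "a = e * (r - star r) * e"
    have "k - sk a - sk (gl (gr r)) = sk (e * gr r) - sk (e * gr (star r))
        + (sk (gl r * e) - sk (gl (star r) * e)) + sk (e * r * f) + sk (f * r * e)"
      by (simp add: k a_def sk_def gl_def gr_def algebra_simps ef_simps)
    also have "\<dots> \<in> M"
      using corner_proj Ref Rfe gen M(1) by (intro subspace_add subspace_diff) auto
    finally show ?thesis using corner_proj[of r] corner_proj[of "r - star r"] by (auto simp: a_def)
  qed
  have to_Ree: "\<exists>a\<in>Ree. k - sk a \<in> M" if "k \<in> K" for k
  proof -
    obtain a b where ab: "a \<in> Ree" "b \<in> Rgg" "k - sk a - sk b \<in> M" using decomp \<open>k \<in> K\<close> by blast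
    obtain c where c: "c \<in> Ree" "sk b - sk c \<in> M" using Rgg_to_Ree ab by blast
    have "k - sk (a + c) \<in> M"
      using subspace_add[OF M(1) ab(3) c(2)] by (simp add: sk_add algebra_simps)
    then show ?thesis using subspace_add[OF subspace_corners(1) ab(1) c(1)] by blast
  qed
  have to_Rgg: "\<exists>b\<in>Rgg. k - sk b \<in> M" if "k \<in> K" for k
  proof -
    obtain a b where ab: "a \<in> Ree" "b \<in> Rgg" "k - sk a - sk b \<in> M" using decomp \<open>k \<in> K\<close> by blast
    obtain c where c: "c \<in> Rgg" "sk a - sk c \<in> M" using Ree_to_Rgg ab by blast
    have "k - sk (c + b) \<in> M"
      using subspace_add[OF M(1) ab(3) c(2)] by (simp add: sk_add algebra_simps)
    then show ?thesis using subspace_add[OF Rgg_sub c(1) ab(2)] by blast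
  qed
  have norm_Ree: "commutator (sk a) m \<in> M" if "a \<in> Ree" "m \<in> M" for a m
    unfolding M_def
  proof (rule commutator_in_hull)
    fix s assume "s \<in> sk ` (Reg \<union> Rge)"
    then obtain x where x: "s = sk x" "x \<in> Reg \<or> x \<in> Rge" by auto
    then have "commutator (sk a) s \<in> M"
      using gen corner_mult that negM by (auto simp: commutator_Ree_Reg commutator_Ree_Rge)
    then show "commutator (sk a) s \<in> subalgebra_wrt scale commutator hull (sk ` (Reg \<union> Rge))"
      by (simp add: M_def)
  qed (use that M_def in auto)
  have norm_Rgg: "commutator (sk b) m \<in> M" if "b \<in> Rgg" "m \<in> M" for b m
    unfolding M_def
  proof (rule commutator_in_hull)
    fix s assume "s \<in> sk ` (Reg \<union> Rge)"
    then obtain x where x: "s = sk x" "x \<in> Reg \<or> x \<in> Rge" by auto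
    then have "commutator (sk b) s \<in> M"
      using gen corner_mult that negM by (auto simp: commutator_Rgg_Reg commutator_Rgg_Rge)
    then show "commutator (sk b) s \<in> subalgebra_wrt scale commutator hull (sk ` (Reg \<union> Rge))"
      by (simp add: M_def)
  qed (use that M_def in auto)
  have "commutator k l \<in> M" if kl: "k \<in> K" "l \<in> K" for k l
  proof -
    \<comment> \<open>\<open>k\<close> and \<open>l\<close> are moved to opposite corners, so that
      the main term, the commutator of \<open>sk a\<close> and \<open>sk b\<close>, vanishes; the
      other terms are in \<open>M\<close> because both corners normalize \<open>M\<close>.\<close>
    obtain a where a: "a \<in> Ree" "k - sk a \<in> M" using to_Ree kl by blast
    obtain b where b: "b \<in> Rgg" "l - sk b \<in> M" using to_Rgg kl by blast
    have "commutator k l = commutator (k - sk a) (l - sk b) - commutator (sk b) (k - sk a)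
        + commutator (sk a) (l - sk b) + commutator (sk a) (sk b)"
      by (simp add: commutator_def algebra_simps)
    also have "\<dots> \<in> M"
      using a b M norm_Ree norm_Rgg commutator_Ree_Rgg
      by (auto intro!: subspace_add subspace_diff simp: subspace_0)
    finally show ?thesis .
  qed
  then have "L \<subseteq> M"
    unfolding commutator_span_def using M(1) by (intro span_minimal) auto
  then show ?thesis by (simp add: M_def)
qed

subsection \<open>Finite generation\<close>

text \<open>The generators of \<open>R\<close> are combinations of finitely many
  \<open>a e b\<close>; let \<open>G\<close> consist of these factors and \<open>e\<close>, and let
  \<open>B\<close> be generated by all \<open>e v u e\<close> with \<open>u\<close>,
  \<open>v\<close> in \<open>G\<close>. The span of \<open>G B G\<close> is closed under products,
  since the inner factor \<open>v u'\<close> is enclosed by \<open>e\<close> on both sides. So it is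
  \<open>R\<close>, and cutting it down by \<open>e\<close> and \<open>g\<close> gives the three
  claims.\<close>

lemma corner_finitely_generated:
  assumes "finitely_generated_wrt scale (*) (UNIV :: 'r set)"
  obtains C X Y where "finite C" "C \<subseteq> Ree" "Ree \<subseteq> subalgebra_wrt scale (*) hull C"
    and "finite X" "X \<subseteq> Reg" "Reg \<subseteq> span {a * x | a x. a \<in> Ree \<and> x \<in> X}"
    and "finite Y" "Y \<subseteq> Rge" "Rge \<subseteq> span {y * a | a y. a \<in> Ree \<and> y \<in> Y}"
proof -
  obtain S where S: "finite S" "subalgebra_wrt scale (*) hull S = (UNIV :: 'r set)"
    using assms by (auto simp: finitely_generated_wrt_def)
  have "S \<subseteq> span ((\<lambda>(a, b). a * e * b) ` UNIV)"
    using in_span_e by (auto simp: image_def case_prod_unfold)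
  then obtain P where P: "finite P" "P \<subseteq> (\<lambda>(a, b). a * e * b) ` UNIV" "S \<subseteq> span P"
    using finite_subset_span[OF S(1)] by metis
  obtain Q where Q: "finite Q" "P = (\<lambda>(a, b). a * e * b) ` Q"
    using finite_subset_image[OF P(1,2)] by auto
  \<comment> \<open>Including \<open>e\<close> puts \<open>e\<close> and every \<open>e u e\<close>
    into \<open>B\<close>, and thus every \<open>u e v\<close> into \<open>G B G\<close>.\<close>
  define G where "G = insert e (fst ` Q \<union> snd ` Q)"
  have G: "finite G" "e \<in> G" using Q by (auto simp: G_def)
  define C where "C = (\<lambda>(v, u). e * (v * (u * e))) ` (G \<times> G)"
  define B where "B = subalgebra_wrt scale (*) hull C"
  have B: "subspace B" "\<And>x y. x \<in> B \<Longrightarrow> y \<in> B \<Longrightarrow> x * y \<in> B"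
    using subalgebra_wrt_hull[of "(*)" C] by (auto simp: subalgebra_wrt_def B_def)
  have CB: "C \<subseteq> B" by (simp add: B_def hull_subset)
  have CRee: "C \<subseteq> Ree" by (auto simp: C_def Ree_def ef_simps)
  have BRee: "B \<subseteq> Ree"
    unfolding B_def using CRee subspace_corners corner_mult
    by (intro hull_minimal) (auto simp: subalgebra_wrt_def)
  have vuB: "e * (v * (u * e)) \<in> B" if "u \<in> G" "v \<in> G" for u v
    using that CB by (auto simp: C_def)
  have eB: "e \<in> B" using vuB[OF G(2) G(2)] by (simp add: idem)
  have euB: "e * (u * e) \<in> B" "e * (v * e) \<in> B" if "u \<in> G" "v \<in> G" for u v
    using vuB[OF that(1) G(2)] vuB[OF G(2) that(1)] vuB[OF G(2) that(2)] by (simp_all add: ef_simps)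
  define W where "W = span {u * b * v | u b v. u \<in> G \<and> v \<in> G \<and> b \<in> B}"
  have W_in: "u * b * v \<in> W" if "u \<in> G" "v \<in> G" "b \<in> B" for u b v
    unfolding W_def using that by (intro span_base) blast
  have "subalgebra_wrt scale (*) W"
    unfolding subalgebra_wrt_def
  proof (intro conjI ballI)
    show "subspace W" by (simp add: W_def)
    fix x y assume xy: "x \<in> W" "y \<in> W"
    show "x * y \<in> W"
    proof (rule span_mult_subset[OF \<open>subspace W\<close> _ xy[unfolded W_def]])
      fix s t
      assume "s \<in> {u * b * v | u b v. u \<in> G \<and> v \<in> G \<and> b \<in> B}"
        and "t \<in> {u * b * v | u b v. u \<in> G \<and> v \<in> G \<and> b \<in> B}"
      then obtain u b v u' b' v' where s: "s = u * b * v" "u \<in> G" "v \<in> G" "b \<in> B"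
        and t: "t = u' * b' * v'" "u' \<in> G" "v' \<in> G" "b' \<in> B" by blast
      have "b * e = b" "e * b' = b'" using BRee s t ReeD by auto
      then have "s * t = u * ((b * (e * (v * (u' * e)))) * b') * v'"
        unfolding s t by (metis mult.assoc)
      also have "\<dots> \<in> W" using s t vuB B by (intro W_in) auto
      finally show "s * t \<in> W" .
    qed
  qed
  moreover have "S \<subseteq> W"
  proof -
    have "P \<subseteq> W"
      unfolding Q using eB by (auto intro!: W_in simp: G_def image_iff) force+
    then have "span P \<subseteq> W" by (simp add: W_def span_minimal)
    then show ?thesis using P by blast
  qed
  ultimately have "subalgebra_wrt scale (*) hull S \<subseteq> W"
    by (intro hull_minimal)
  then have W: "r \<in> span {u * b * v | u b v. u \<in> G \<and> v \<in> G \<and> b \<in> B}" for r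
    using S by (auto simp: W_def)
  have "Ree \<subseteq> B"
  proof
    fix a assume a: "a \<in> Ree"
    have "e * a * e \<in> B"
    proof (rule span_image_subset[where h = "\<lambda>p. e * p * e", OF _ _ B(1) _ W])
      fix t assume "t \<in> {u * b * v | u b v. u \<in> G \<and> v \<in> G \<and> b \<in> B}"
      then obtain u b v where t: "t = u * b * v" "u \<in> G" "v \<in> G" "b \<in> B" by blast
      have "b * e = b" "e * b = b" using BRee t ReeD by auto
      then have "e * t * e = (e * (u * e)) * b * (e * (v * e))"
        unfolding t by (metis mult.assoc)
      then show "e * t * e \<in> B" using euB t B by simp
    qed (auto simp: algebra_simps scale_mult_left scale_mult_right)
    then show "a \<in> B" using a by (simp add: Ree_def)
  qed
  moreover have "Reg \<subseteq> span {a * x | a x. a \<in> Ree \<and> x \<in> (\<lambda>v. e * gr v) ` G}" (is "_ \<subseteq> span ?X")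
  proof
    fix x assume x: "x \<in> Reg"
    have "e * gr x \<in> span ?X"
    proof (rule span_image_subset[where h = "\<lambda>p. e * gr p", OF _ _ _ _ W])
      fix t assume "t \<in> {u * b * v | u b v. u \<in> G \<and> v \<in> G \<and> b \<in> B}"
      then obtain u b v where t: "t = u * b * v" "u \<in> G" "v \<in> G" "b \<in> B" by blast
      have b: "b * e = b" "e * b = b" using BRee t ReeD by auto
      have "e * gr t = e * u * b * gr v"
        unfolding t gr_def by (simp add: algebra_simps)
      also have "\<dots> = ((e * (u * e)) * b) * (e * gr v)"
        using b by (metis mult.assoc)
      finally have "e * gr t = ((e * (u * e)) * b) * (e * gr v)" .
      moreover have "(e * (u * e)) * b \<in> Ree" using euB t B BRee by auto
      ultimately show "e * gr t \<in> span ?X" using t by (auto intro!: span_base)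
    qed (auto simp: gr_def algebra_simps scale_mult_left scale_mult_right scale_right_diff_distrib)
    then show "x \<in> span ?X" using RegD[OF x] by (simp add: gr_def)
  qed
  moreover have "Rge \<subseteq> span {y * a | a y. a \<in> Ree \<and> y \<in> (\<lambda>u. gl u * e) ` G}" (is "_ \<subseteq> span ?Y")
  proof
    fix y assume y: "y \<in> Rge"
    have "gl y * e \<in> span ?Y"
    proof (rule span_image_subset[where h = "\<lambda>p. gl p * e", OF _ _ _ _ W])
      fix t assume "t \<in> {u * b * v | u b v. u \<in> G \<and> v \<in> G \<and> b \<in> B}"
      then obtain u b v where t: "t = u * b * v" "u \<in> G" "v \<in> G" "b \<in> B" by blast
      have b: "b * e = b" "e * b = b" using BRee t ReeD by auto
      have "gl t * e = gl u * b * v * e"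
        unfolding t gl_def by (simp add: algebra_simps)
      also have "\<dots> = (gl u * e) * (b * (e * (v * e)))"
        using b by (metis mult.assoc)
      finally have "gl t * e = (gl u * e) * (b * (e * (v * e)))" .
      moreover have "b * (e * (v * e)) \<in> Ree" using euB t B BRee by auto
      ultimately show "gl t * e \<in> span ?Y" using t by (auto intro!: span_base)
    qed (auto simp: gl_def algebra_simps scale_mult_left scale_mult_right scale_right_diff_distrib)
    then show "y \<in> span ?Y" using RgeD[OF y] by (simp add: gl_def)
  qed
  ultimately show thesis
    using G CRee corner_proj
    by (intro that[of C "(\<lambda>v. e * gr v) ` G" "(\<lambda>u. gl u * e) ` G"]) (auto simp: B_def C_def)
qed

section \<open>Words in the corner \<open>Ree\<close>\<close>

lemma foldr_left: "e * z = z \<Longrightarrow> set u \<subseteq> Ree \<Longrightarrow> foldr (*) u z = foldr (*) u e * z"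
  by (induction u) (auto simp: mult.assoc)

text \<open>\<open>foldr\<close> applies the last letter first, so on the right of \<open>z\<close>
  the letters appear in reverse order.\<close>

lemma foldr_right:
  assumes "z * e = z" "set u \<subseteq> Ree"
  shows "foldr (\<lambda>t z. z * t) u z = z * foldr (*) (rev u) e"
  using assms(2)
proof (induction u)
  case (Cons t u)
  have t: "t * e = t" "e * t = t" using Cons ReeD by auto
  have "foldr (*) (rev u) t = foldr (*) (rev u) e * t"
    using Cons t by (intro foldr_left) auto
  then show ?case using Cons t by (simp add: mult.assoc)
qed (simp add: assms)

lemma foldr_in_Ree: "set u \<subseteq> Ree \<Longrightarrow> foldr (*) u e \<in> Ree"
  by (induction u) (auto simp: e_in_Ree corner_mult)

text \<open>Concatenation makes the span of the words multiplicatively closed; the empty word stands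
  for \<open>e\<close>, the identity of the corner.\<close>

lemma hull_subset_span_words:
  assumes "T \<subseteq> Ree"
  shows "subalgebra_wrt scale (*) hull T \<subseteq> span ((\<lambda>w. foldr (*) w e) ` {w. set w \<subseteq> T})"
    (is "_ \<subseteq> span ?W")
proof (rule hull_minimal)
  show "T \<subseteq> span ?W"
  proof
    fix t assume "t \<in> T"
    moreover have "t = foldr (*) [t] e" using assms \<open>t \<in> T\<close> ReeD by auto
    ultimately show "t \<in> span ?W" by (intro span_base) (auto simp del: foldr.simps intro!: image_eqI)
  qed
  show "subalgebra_wrt scale (*) (span ?W)"
    unfolding subalgebra_wrt_def
  proof (intro conjI ballI)
    fix x y assume "x \<in> span ?W" "y \<in> span ?W"
    then show "x * y \<in> span ?W"
    proof (rule span_mult_subset[rotated 2])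
      fix a b assume "a \<in> ?W" "b \<in> ?W"
      then obtain u v where u: "a = foldr (*) u e" "set u \<subseteq> T" and v: "b = foldr (*) v e" "set v \<subseteq> T"
        by auto
      have "a * b = foldr (*) (u @ v) e"
        using foldr_left[of b u] ReeD(1)[OF foldr_in_Ree[of v]] assms u v by auto
      then show "a * b \<in> span ?W"
        using u v by (intro span_base image_eqI[of _ _ "u @ v"]) auto
    qed simp
  qed simp
qed

lemma finitely_generated_L:
  assumes "finitely_generated_wrt scale (*) (UNIV :: 'r set)"
  shows "finitely_generated_wrt scale commutator L"
proof -
  obtain C X Y where C: "finite C" "C \<subseteq> Ree" "Ree \<subseteq> subalgebra_wrt scale (*) hull C"
    and X: "finite X" "X \<subseteq> Reg" "Reg \<subseteq> span {a * x | a x. a \<in> Ree \<and> x \<in> X}"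
    and Y: "finite Y" "Y \<subseteq> Rge" "Rge \<subseteq> span {y * a | a y. a \<in> Ree \<and> y \<in> Y}"
    by (rule corner_finitely_generated[OF assms])
  have "C \<subseteq> span signed_products" using C(2) Ree_subset_span_signed by blast
  then obtain T where T: "finite T" "T \<subseteq> signed_products" "C \<subseteq> span T"
    by (rule finite_subset_span[OF C(1)])
  have TRee: "T \<subseteq> Ree" using T(2) signed_products_subset by blast
  have "span T \<subseteq> subalgebra_wrt scale (*) hull T"
    using subalgebra_wrt_hull[of "(*)" T]
    by (intro span_minimal hull_subset) (simp add: subalgebra_wrt_def)
  then have "subalgebra_wrt scale (*) hull C \<subseteq> subalgebra_wrt scale (*) hull T"
    using T(3) subalgebra_wrt_hull by (intro hull_minimal) auto
  then have words: "Ree \<subseteq> span ((\<lambda>w. foldr (*) w e) ` {w. set w \<subseteq> T})"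
    using C(3) hull_subset_span_words[OF TRee] by blast
  define n where "n = card T"
  define N where "N = (\<lambda>w. foldr (*) w e) ` {w. set w \<subseteq> T \<and> length w \<le> n}"
  have N: "finite N" using finite_lists_length_le[OF T(1)] by (simp add: N_def)
  have NRee: "N \<subseteq> Ree" using foldr_in_Ree TRee by (auto simp: N_def)
  have N_in: "foldr (*) w e \<in> N" if "set w \<subseteq> T" "length w \<le> card T" for w
    using that by (auto simp: N_def n_def)
  \<comment> \<open>The three families provide the hypotheses \<open>square\<close>,
    \<open>comm\<close> and \<open>comm2\<close> of \<open>foldr_in_closed\<close>; the products of
    \<open>N\<close> with \<open>X\<close> and \<open>Y\<close> in \<open>Gen\<close> provide
    \<open>base\<close>.\<close>
  define D where "D = (\<lambda>t. t * t) ` T \<union> (\<lambda>(s, t). commutator s t) ` (T \<times> T)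
    \<union> (\<lambda>(c, s, t). commutator c (commutator s t)) ` (N \<times> T \<times> T)"
  define Gen where "Gen = sk ` (D \<union> (\<lambda>(c, x). c * x) ` (N \<times> X) \<union> (\<lambda>(y, c). y * c) ` (Y \<times> N))"
  define M where "M = subalgebra_wrt scale commutator hull Gen"
  have M: "subspace M" "\<And>x y. x \<in> M \<Longrightarrow> y \<in> M \<Longrightarrow> commutator x y \<in> M"
    using subalgebra_wrt_hull[of commutator Gen] by (auto simp: subalgebra_wrt_def M_def)
  have Gen_M: "Gen \<subseteq> M" by (simp add: M_def hull_subset)
  have comm_Ree: "commutator a b \<in> Ree" if "a \<in> Ree" "b \<in> Ree" for a b
    using that corner_mult subspace_diff[OF subspace_corners(1)] by (simp add: commutator_def)
  have DRee: "D \<subseteq> Ree"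
    using subsetD[OF TRee] subsetD[OF NRee] comm_Ree corner_mult(1) by (auto simp: D_def)
  have DL: "sk d \<in> L" if "d \<in> D" for d
    using that subsetD[OF T(2)] subsetD[OF TRee] subsetD[OF NRee] comm_Ree
      sk_square_in_L sk_commutator_in_L by (auto simp: D_def)
  have "finite Gen"
    using T(1) N X(1) Y(1) by (auto simp: Gen_def D_def)
  have GenL: "Gen \<subseteq> L"
    using DL subsetD[OF NRee] subsetD[OF X(2)] subsetD[OF Y(2)] corner_mult(2,3)
      sk_Reg_in_L sk_Rge_in_L by (auto simp: Gen_def)
  have DM: "sk d \<in> M" if "d \<in> D" for d
    using that Gen_M by (auto simp: Gen_def)
  have D_in: "t * t \<in> D" "commutator s t \<in> D" "c \<in> N \<Longrightarrow> commutator c (commutator s t) \<in> D"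
    if "s \<in> T" "t \<in> T" for s t c
    using that by (force simp: D_def)+
  define Qx where "Qx = {x \<in> Reg. sk x \<in> M}"
  define Qy where "Qy = {y \<in> Rge. sk y \<in> M}"
  have subQ: "subspace Qx" "subspace Qy"
    using subspace_inter[OF subspace_corners(2) subspace_sk_preimage[OF M(1)]]
      subspace_inter[OF subspace_corners(3) subspace_sk_preimage[OF M(1)]]
    by (simp_all add: Qx_def Qy_def Int_def)
  \<comment> \<open>\<open>sk d\<close> acts on \<open>sk q\<close> as left multiplication by
    \<open>d\<close>, so closure of \<open>M\<close> under commutators becomes closure of
    \<open>Qx\<close> under multiplication by \<open>D\<close>.\<close>
  have Qx_mult: "d * q \<in> Qx" if "d \<in> D" "q \<in> Qx" for d q
    using that DM[of d] DRee M(2)[of "sk d" "sk q"] corner_mult(2)[of d q]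
    by (auto simp: Qx_def commutator_Ree_Reg subsetD)
  have Qy_mult: "q * d \<in> Qy" if "d \<in> D" "q \<in> Qy" for d q
    using that DM[of d] DRee M(2)[of "sk d" "sk q"] corner_mult(3)[of q d]
      subspace_neg[OF M(1), of "- sk (q * d)"]
    by (auto simp: Qy_def commutator_Ree_Rge subsetD)
  have left: "foldr (*) w x \<in> Qx" if x: "x \<in> X" and w: "set w \<subseteq> T" for x w
  proof (rule foldr_in_closed[OF T(1) _ _ _ _ _ _ _ w])
    fix v assume v: "set v \<subseteq> T" "length v \<le> card T"
    have eq: "foldr (*) v x = foldr (*) v e * x"
      using x X(2) RegD v TRee by (intro foldr_left) auto
    moreover have "foldr (*) v e * x \<in> Reg"
      using N_in[OF v] NRee x X(2) corner_mult(2) by blast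
    moreover have "sk (foldr (*) v e * x) \<in> Gen"
      unfolding Gen_def using N_in[OF v] x by (intro imageI) force
    ultimately show "foldr (*) v x \<in> Qx" using Gen_M by (auto simp: Qx_def)
  next
    fix u s t q assume u: "set u \<subseteq> T" "length u \<le> card T" and st: "s \<in> T" "t \<in> T" and q: "q \<in> Qx"
    have est: "e * (s * z) = s * z" "e * (t * z) = t * z" for z
      using ReeD(1)[OF subsetD[OF TRee]] st by (simp_all add: mult.assoc[symmetric])
    have eq: "e * q = q" "e * (s * (t * q) - t * (s * q)) = s * (t * q) - t * (s * q)"
      using q RegD(1) by (simp_all add: Qx_def right_diff_distrib est)
    have U: "foldr (*) u q = foldr (*) u e * q"
      "foldr (*) u (s * (t * q) - t * (s * q)) = foldr (*) u e * (s * (t * q) - t * (s * q))"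
      using foldr_left[OF eq(1)] foldr_left[OF eq(2)] u TRee by auto
    \<comment> \<open>The difference demanded by \<open>comm2\<close> is the double commutator of
      the word \<open>u\<close> with \<open>s\<close> and \<open>t\<close>, applied to
      \<open>q\<close>.\<close>
    have "commutator (foldr (*) u e) (commutator s t) * q \<in> Qx"
      using D_in(3)[OF st N_in[OF u]] Qx_mult q by blast
    then show "foldr (*) u (s * (t * q) - t * (s * q))
        - (s * (t * foldr (*) u q) - t * (s * foldr (*) u q)) \<in> Qx"
      unfolding U by (simp add: commutator_def algebra_simps)
  next
    fix s t q assume "s \<in> T" "t \<in> T" "q \<in> Qx"
    then show "s * (t * q) - t * (s * q) \<in> Qx"
      using Qx_mult[OF D_in(2)] by (simp add: commutator_def algebra_simps)
  next
    fix t q assume "t \<in> T" "q \<in> Qx"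
    then show "t * (t * q) \<in> Qx"
      using Qx_mult[OF D_in(1)] by (simp add: mult.assoc)
  qed (use subQ in \<open>auto simp: distrib_left subspace_0 subspace_diff\<close>)
  have right: "foldr (\<lambda>t z. z * t) w y \<in> Qy" if y: "y \<in> Y" and w: "set w \<subseteq> T" for y w
  proof (rule foldr_in_closed[OF T(1) _ _ _ _ _ _ _ w])
    fix v assume v: "set v \<subseteq> T" "length v \<le> card T"
    then have rv: "set (rev v) \<subseteq> T" "length (rev v) \<le> card T" by auto
    have eq: "foldr (\<lambda>t z. z * t) v y = y * foldr (*) (rev v) e"
      using y Y(2) RgeD v TRee by (intro foldr_right) auto
    moreover have "y * foldr (*) (rev v) e \<in> Rge"
      using N_in[OF rv] NRee y Y(2) corner_mult(3) by blast
    moreover have "sk (y * foldr (*) (rev v) e) \<in> Gen"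
      unfolding Gen_def using N_in[OF rv] y by (intro imageI) force
    ultimately show "foldr (\<lambda>t z. z * t) v y \<in> Qy" using Gen_M by (auto simp: Qy_def)
  next
    fix u s t q assume u: "set u \<subseteq> T" "length u \<le> card T" and st: "s \<in> T" "t \<in> T" and q: "q \<in> Qy"
    then have ru: "set (rev u) \<subseteq> T" "length (rev u) \<le> card T" by auto
    have eq: "q * e = q" "(q * t * s - q * s * t) * e = q * t * s - q * s * t"
      using q RgeD(1) ReeD(2)[OF subsetD[OF TRee]] st
      by (simp_all add: Qy_def left_diff_distrib mult.assoc)
    have U: "foldr (\<lambda>t z. z * t) u q = q * foldr (*) (rev u) e"
      "foldr (\<lambda>t z. z * t) u (q * t * s - q * s * t) = (q * t * s - q * s * t) * foldr (*) (rev u) e"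
      using foldr_right[OF eq(1)] foldr_right[OF eq(2)] u TRee by auto
    \<comment> \<open>Right multiplications compose in reverse order; this reverses both the inner
      and the outer commutator, so the two signs cancel.\<close>
    have "q * commutator (foldr (*) (rev u) e) (commutator s t) \<in> Qy"
      using D_in(3)[OF st N_in[OF ru]] Qy_mult q by blast
    then show "foldr (\<lambda>t z. z * t) u (q * t * s - q * s * t)
        - (foldr (\<lambda>t z. z * t) u q * t * s - foldr (\<lambda>t z. z * t) u q * s * t) \<in> Qy"
      unfolding U by (simp add: commutator_def algebra_simps)
  next
    fix s t q assume "s \<in> T" "t \<in> T" "q \<in> Qy"
    \<comment> \<open>Here only one commutator is reversed, so \<open>s\<close> and \<open>t\<close>
      change places.\<close>
    then show "q * t * s - q * s * t \<in> Qy"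
      using Qy_mult[OF D_in(2), of t s q] by (simp add: commutator_def algebra_simps)
  next
    fix t q assume "t \<in> T" "q \<in> Qy"
    then show "q * t * t \<in> Qy"
      using Qy_mult[OF D_in(1)] by (simp add: mult.assoc)
  qed (use subQ in \<open>auto simp: distrib_right subspace_0 subspace_diff\<close>)
  have "Reg \<subseteq> Qx"
  proof -
    have "a * x \<in> Qx" if "a \<in> Ree" "x \<in> X" for a x
    proof (rule span_image_subset[where h = "\<lambda>a. a * x", OF _ _ subQ(1) _ subsetD[OF words that(1)]])
      fix b assume "b \<in> (\<lambda>w. foldr (*) w e) ` {w. set w \<subseteq> T}"
      then obtain w where w: "b = foldr (*) w e" "set w \<subseteq> T" by auto
      have "foldr (*) w x = b * x"
        unfolding w(1) using that X(2) RegD w TRee by (intro foldr_left) auto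
      then show "b * x \<in> Qx" using left[OF that(2) w(2)] by simp
    qed (auto simp: distrib_right scale_mult_left)
    then have "span {a * x | a x. a \<in> Ree \<and> x \<in> X} \<subseteq> Qx"
      using subQ by (intro span_minimal) auto
    then show ?thesis using X(3) by blast
  qed
  moreover have "Rge \<subseteq> Qy"
  proof -
    have "y * a \<in> Qy" if "a \<in> Ree" "y \<in> Y" for a y
    proof (rule span_image_subset[where h = "\<lambda>a. y * a", OF _ _ subQ(2) _ subsetD[OF words that(1)]])
      fix b assume "b \<in> (\<lambda>w. foldr (*) w e) ` {w. set w \<subseteq> T}"
      then obtain w where w: "b = foldr (*) w e" "set w \<subseteq> T" by auto
      \<comment> \<open>Reversing \<open>w\<close> beforehand compensates for the reversal in
        \<open>foldr_right\<close>.\<close>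
      have "foldr (\<lambda>t z. z * t) (rev w) y = y * foldr (*) (rev (rev w)) e"
        using that Y(2) RgeD w TRee by (intro foldr_right) auto
      then show "y * b \<in> Qy" using right[OF that(2), of "rev w"] w by simp
    qed (auto simp: distrib_left scale_mult_right)
    then have "span {y * a | a y. a \<in> Ree \<and> y \<in> Y} \<subseteq> Qy"
      using subQ by (intro span_minimal) auto
    then show ?thesis using Y(3) by blast
  qed
  ultimately have "sk ` (Reg \<union> Rge) \<subseteq> M"
    by (auto simp: Qx_def Qy_def)
  then have "subalgebra_wrt scale commutator hull (sk ` (Reg \<union> Rge)) \<subseteq> M"
    unfolding M_def using subalgebra_wrt_hull by (intro hull_minimal)
  then have "L \<subseteq> M" using L_subset_hull by blast
  moreover have "M \<subseteq> L"
    unfolding M_def using GenL subalgebra_commutator_span_skew by (intro hull_minimal)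
  ultimately have "subalgebra_wrt scale commutator hull Gen = L" by (simp add: M_def)
  then show ?thesis
    unfolding finitely_generated_wrt_def
    using \<open>finite Gen\<close> GenL subalgebra_commutator_span_skew by blast
qed

end

theorem theorem2:
  fixes scale :: "'f::field \<Rightarrow> 'r::ring \<Rightarrow> 'r"
    and star :: "'r \<Rightarrow> 'r"
    and e :: 'r
  assumes char_not_2: "CHAR('f) \<noteq> 2"
    and involution: "algebra_with_involution scale star"
    and fin_gen: "finitely_generated_wrt scale (*) (UNIV :: 'r set)"
    and idempotent: "e * e = e"
    and orthogonal: "e * star e = 0" "star e * e = 0"
    and full: "ideal_span scale e = UNIV"
    and full_complement: "complement_ideal_span scale e (star e) = UNIV"
  shows "finitely_generated_wrt scale commutator (commutator_span scale (skew_elements star))"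
proof -
  \<comment> \<open>A divisor of the prime \<open>2\<close> is \<open>1\<close> or \<open>2\<close>,
    and a field cannot have characteristic \<open>1\<close>.\<close>
  have "\<not> CHAR('f) dvd 2"
    using char_not_2 CHAR_not_1[where 'a = 'f] two_is_prime_nat[unfolded prime_nat_iff One_nat_def]
    by auto
  then have "(2 :: 'f) \<noteq> 0"
    using of_nat_eq_0_iff_char_dvd[of 2, where 'a = 'f] by simp
  then interpret full_split_involution scale star e
    using assms by (simp add: full_split_involution_def full_split_involution_axioms_def)
  show ?thesis by (rule finitely_generated_L[OF fin_gen])
qed

end
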